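(* Let $G$ be a group and let $A$ be a subset of $G$. The following statements are equivalent: (i) $A$ is sparse, that is, $\Delta_p(A)$ is finite for every $p\in G^*$; (ii) every ultrafilter $p\in A^*$ is strongly prime, that is, $p\in G^*\setminus\overline{G^*G^*}$ for every $p\in A^*$; (iii) for every infinite subset $X$ of $G$, there exists a finite subset $F\subset X$ such that $\bigcap_{g\in F}gA$ is finite.
   Context: $G$ is a discrete group. $\beta G$ is the Stone-Čech compactification of $G$, whose points are the ultrafilters on $G$ (points of $G$ being identified with principal ultrafilters), with base of open sets $\overline{A}=\{p\in\beta G: A\in p\}$, $A\subseteq G$. $G^*=\beta G\setminus G$ is the set of free ultrafilters on $G$, and $A^*=\overline{A}\cap G^*$ for $A\subseteq G$. $\beta G$ is a semigroup under the product defined by: for $A\subseteq G$, $A\in pq$ if and only if $\{g\in G: g^{-1}A\in q\}\in p$; $G^*$ is a subsemigroup. For $p\in\beta G$, $Gp=\{gp:g\in G\}$, and $G^*G^*=\{pq:p,q\in G^*\}$; $\overline{G^*G^*}$ is its closure in $\beta G$. For $A\subseteq G$ and $p\in G^*$, the $p$-companion of $A$ is $\Delta_p(A)=A^*\cap Gp=\{gp: g\in G,\ A\in gp\}$. *)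

theory Defs
  imports "HOL-Algebra.Coset" "HOL-Analysis.Abstract_Topology"
begin

definition ultrafilter_on :: "'a set \<Rightarrow> 'a set set \<Rightarrow> bool" where
  "ultrafilter_on X p \<longleftrightarrow>
     p \<subseteq> Pow X \<and> X \<in> p \<and> {} \<notin> p \<and>
     (\<forall>A\<in>p. \<forall>B\<in>p. A \<inter> B \<in> p) \<and>
     (\<forall>A\<in>p. \<forall>B. A \<subseteq> B \<and> B \<subseteq> X \<longrightarrow> B \<in> p) \<and>
     (\<forall>A. A \<subseteq> X \<longrightarrow> A \<in> p \<or> X - A \<in> p)"

definition stone_cech :: "'a set \<Rightarrow> 'a set set set" where
  "stone_cech X = {p. ultrafilter_on X p}"

definition principal_ultrafilter :: "'a set \<Rightarrow> 'a \<Rightarrow> 'a set set" where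
  "principal_ultrafilter X x = {A. A \<subseteq> X \<and> x \<in> A}"

definition free_ultrafilters :: "'a set \<Rightarrow> 'a set set set" where
  "free_ultrafilters X = stone_cech X - principal_ultrafilter X ` X"

definition basic_open :: "'a set \<Rightarrow> 'a set \<Rightarrow> 'a set set set" where
  "basic_open X A = {p \<in> stone_cech X. A \<in> p}"

text \<open>The sets \<open>basic_open X A\<close> are closed under finite intersections and
  \<open>basic_open X X = stone_cech X\<close>, so they form a base of the topology they generate,
  whose underlying space is \<open>stone_cech X\<close>.\<close>

definition stone_cech_topology :: "'a set \<Rightarrow> 'a set set topology" where
  "stone_cech_topology X = topology_generated_by {basic_open X A | A. A \<subseteq> X}"

definition star_set :: "'a set \<Rightarrow> 'a set \<Rightarrow> 'a set set set" where
  "star_set X A = basic_open X A \<inter> free_ultrafilters X"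

definition ultrafilter_mult ::
    "('a, 'b) monoid_scheme \<Rightarrow> 'a set set \<Rightarrow> 'a set set \<Rightarrow> 'a set set" where
  "ultrafilter_mult G p q =
     {A. A \<subseteq> carrier G \<and> {g \<in> carrier G. (inv\<^bsub>G\<^esub> g) <#\<^bsub>G\<^esub> A \<in> q} \<in> p}"

definition ultrafilter_orbit :: "('a, 'b) monoid_scheme \<Rightarrow> 'a set set \<Rightarrow> 'a set set set" where
  "ultrafilter_orbit G p =
     {ultrafilter_mult G (principal_ultrafilter (carrier G) g) p | g. g \<in> carrier G}"

definition companion ::
    "('a, 'b) monoid_scheme \<Rightarrow> 'a set set \<Rightarrow> 'a set \<Rightarrow> 'a set set set" where
  "companion G p A = star_set (carrier G) A \<inter> ultrafilter_orbit G p"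

definition sparse_subset :: "('a, 'b) monoid_scheme \<Rightarrow> 'a set \<Rightarrow> bool" where
  "sparse_subset G A \<longleftrightarrow> (\<forall>p \<in> free_ultrafilters (carrier G). finite (companion G p A))"

definition strongly_prime :: "('a, 'b) monoid_scheme \<Rightarrow> 'a set set \<Rightarrow> bool" where
  "strongly_prime G p \<longleftrightarrow>
     p \<in> free_ultrafilters (carrier G) -
         (stone_cech_topology (carrier G) closure_of
            {ultrafilter_mult G q r | q r.
               q \<in> free_ultrafilters (carrier G) \<and> r \<in> free_ultrafilters (carrier G)})"

end

theory Submission
  imports Defs
begin

text \<open>For an ultrafilter \<open>r\<close> let \<open>B\<^sub>r = {g. g\<^sup>-\<^sup>1A \<in> r}\<close>, the set of all \<open>g\<close> with
  \<open>A \<in> gr\<close>. Each of the three conditions fails exactly when \<open>B\<^sub>r\<close> is infinite for some free \<open>r\<close>.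

  For sparseness this is because a group acts freely on its ultrafilters
  (\<open>left_translates_distinct\<close>): distinct \<open>g \<in> B\<^sub>r\<close> give distinct points \<open>gr\<close> of the companion, so
  the companion of \<open>A\<close> at \<open>r\<close> is infinite exactly when \<open>B\<^sub>r\<close> is.
  For strong primeness, \<open>A \<in> qr\<close> means \<open>B\<^sub>r \<in> q\<close>, and a free \<open>q\<close> containing \<open>B\<^sub>r\<close> exists if and
  only if \<open>B\<^sub>r\<close> is infinite. Closure makes no difference here, since the set of ultrafilters
  containing \<open>A\<close> is open: it meets the closure of the set of products only if it meets that set.
  For the combinatorial condition, \<open>x\<^sup>-\<^sup>1 \<in> B\<^sub>r\<close> means \<open>xA \<in> r\<close>. A free ultrafilter containing all
  translates \<open>xA\<close> with \<open>x\<close> in an infinite set \<open>X\<close> exists exactly when all finite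
  intersections of these translates are infinite (\<open>free_ultrafilter_extension\<close>).\<close>

section \<open>Ultrafilters\<close>

lemma ultrafilter_compl_iff:
  assumes "ultrafilter_on X p" and "S \<subseteq> X"
  shows "X - S \<in> p \<longleftrightarrow> S \<notin> p"
proof -
  have "S \<inter> (X - S) = {}" by blast
  then show ?thesis
    using assms unfolding ultrafilter_on_def by metis
qed

lemma ultrafilter_Inter:
  assumes "ultrafilter_on X p" and "finite F" and "F \<subseteq> p"
  shows "X \<inter> \<Inter>F \<in> p"
  using assms(2,3)
proof (induction F rule: finite_induct)
  case empty
  then show ?case using assms(1) by (simp add: ultrafilter_on_def)
next
  case (insert S F)
  have "X \<inter> \<Inter>(insert S F) = S \<inter> (X \<inter> \<Inter>F)" by blast
  then show ?case using insert assms(1) by (simp add: ultrafilter_on_def)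
qed

lemma ultrafilter_on_principal:
  "x \<in> X \<Longrightarrow> ultrafilter_on X (principal_ultrafilter X x)"
  by (auto simp: ultrafilter_on_def principal_ultrafilter_def)

text \<open>A one-point member makes an ultrafilter principal. Without such members, points can be
  removed one at a time from a member without leaving the ultrafilter, so a finite member would
  lead to the empty set.\<close>

lemma free_ultrafilters_iff:
  "p \<in> free_ultrafilters X \<longleftrightarrow> ultrafilter_on X p \<and> (\<forall>S\<in>p. infinite S)"
proof
  assume p: "p \<in> free_ultrafilters X"
  then have u: "ultrafilter_on X p"
    by (simp add: free_ultrafilters_def stone_cech_def)
  have no_singleton: "{x} \<notin> p" if "x \<in> X" for x
  proof
    assume x: "{x} \<in> p"
    have "p = principal_ultrafilter X x"
    proof (intro equalityI subsetI)
      fix S assume S: "S \<in> p"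
      then have "S \<inter> {x} \<in> p" "S \<subseteq> X" using x u by (auto simp: ultrafilter_on_def)
      then have "S \<inter> {x} \<noteq> {}" using u by (metis ultrafilter_on_def)
      then show "S \<in> principal_ultrafilter X x"
        using \<open>S \<subseteq> X\<close> by (auto simp: principal_ultrafilter_def)
    next
      fix S assume "S \<in> principal_ultrafilter X x"
      then have "{x} \<subseteq> S" "S \<subseteq> X" by (auto simp: principal_ultrafilter_def)
      then show "S \<in> p" using x u unfolding ultrafilter_on_def by blast
    qed
    then show False using p that by (auto simp: free_ultrafilters_def)
  qed
  have "S \<notin> p" if "finite S" for S
    using that
  proof (induction S rule: finite_induct)
    case empty
    then show ?case using u by (simp add: ultrafilter_on_def)
  next
    case (insert x S)
    show ?case
    proof
      assume m: "insert x S \<in> p"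
      then have sub: "insert x S \<subseteq> X" using u by (auto simp: ultrafilter_on_def)
      then have "X - {x} \<in> p" using ultrafilter_compl_iff[OF u] no_singleton by simp
      then have "insert x S \<inter> (X - {x}) \<in> p"
        using m u unfolding ultrafilter_on_def by blast
      moreover have "insert x S \<inter> (X - {x}) = S" using sub insert by blast
      ultimately show False using insert by simp
    qed
  qed
  then show "ultrafilter_on X p \<and> (\<forall>S\<in>p. infinite S)" using u by blast
next
  assume r: "ultrafilter_on X p \<and> (\<forall>S\<in>p. infinite S)"
  have "p \<noteq> principal_ultrafilter X x" if "x \<in> X" for x
  proof
    assume "p = principal_ultrafilter X x"
    then have "{x} \<in> p" using that by (simp add: principal_ultrafilter_def)
    then show False using r by blast
  qed
  then show "p \<in> free_ultrafilters X"
    using r by (auto simp: free_ultrafilters_def stone_cech_def)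
qed

text \<open>A family that is maximal among those whose finite intersections are all infinite is
  already an ultrafilter, and it is free because its members are infinite. So Zorn's lemma is
  applied to this property instead of the usual finite intersection property.\<close>

lemma free_ultrafilter_extension:
  assumes E: "E \<subseteq> Pow X"
    and inf: "\<And>F. finite F \<Longrightarrow> F \<subseteq> E \<Longrightarrow> infinite (X \<inter> \<Inter>F)"
  obtains p where "p \<in> free_ultrafilters X" and "E \<subseteq> p"
proof -
  define \<Phi> where
    "\<Phi> = {M. E \<subseteq> M \<and> M \<subseteq> Pow X \<and> (\<forall>F. finite F \<and> F \<subseteq> M \<longrightarrow> infinite (X \<inter> \<Inter>F))}"
  have "\<exists>M\<in>\<Phi>. \<forall>N\<in>\<Phi>. M \<subseteq> N \<longrightarrow> N = M"
  proof (rule subset_Zorn_nonempty)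
    have "E \<in> \<Phi>" using E inf by (simp add: \<Phi>_def)
    then show "\<Phi> \<noteq> {}" by blast
    fix C assume C: "C \<noteq> {}" "subset.chain \<Phi> C"
    have "infinite (X \<inter> \<Inter>F)" if F: "finite F" "F \<subseteq> \<Union>C" for F
    proof -
      obtain M where "M \<in> C" "F \<subseteq> M"
        using finite_subset_Union_chain[OF F C] by blast
      moreover then have "M \<in> \<Phi>" using C by (auto simp: subset.chain_def)
      ultimately show ?thesis using F by (auto simp: \<Phi>_def)
    qed
    moreover have "E \<subseteq> \<Union>C" "\<Union>C \<subseteq> Pow X"
      using C by (fastforce simp: subset.chain_def \<Phi>_def)+
    ultimately show "\<Union>C \<in> \<Phi>" by (auto simp: \<Phi>_def)
  qed
  then obtain M where M: "M \<in> \<Phi>" and max: "\<And>N. N \<in> \<Phi> \<Longrightarrow> M \<subseteq> N \<Longrightarrow> N = M"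
    by blast
  have EM: "E \<subseteq> M" and MX: "M \<subseteq> Pow X"
    and Minf: "\<And>F. finite F \<Longrightarrow> F \<subseteq> M \<Longrightarrow> infinite (X \<inter> \<Inter>F)"
    using M by (auto simp: \<Phi>_def)
  have mem: "S \<in> M"
    if S: "S \<subseteq> X" and *: "\<And>F. finite F \<Longrightarrow> F \<subseteq> M \<Longrightarrow> infinite (X \<inter> \<Inter>F \<inter> S)" for S
  proof -
    have "infinite (X \<inter> \<Inter>F)" if F: "finite F" "F \<subseteq> insert S M" for F
    proof -
      have "infinite (X \<inter> \<Inter>(F - {S}) \<inter> S)" using *[of "F - {S}"] F by blast
      moreover have "X \<inter> \<Inter>(F - {S}) \<inter> S \<subseteq> X \<inter> \<Inter>F" by blast
      ultimately show ?thesis using finite_subset by blast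
    qed
    then have "insert S M \<in> \<Phi>" using EM MX S by (auto simp: \<Phi>_def)
    then show ?thesis using max[of "insert S M"] by blast
  qed
  have Mone: "infinite S" if "S \<in> M" for S
    using Minf[of "{S}"] that by auto
  have "ultrafilter_on X M"
    unfolding ultrafilter_on_def
  proof (intro conjI ballI allI impI)
    show "M \<subseteq> Pow X" by (rule MX)
    show "X \<in> M"
    proof (rule mem)
      fix F assume "finite F" "F \<subseteq> M"
      moreover have "X \<inter> \<Inter>F \<inter> X = X \<inter> \<Inter>F" by blast
      ultimately show "infinite (X \<inter> \<Inter>F \<inter> X)" using Minf by metis
    qed simp
    show "{} \<notin> M" using Mone by blast
    show "S \<inter> T \<in> M" if "S \<in> M" "T \<in> M" for S T
    proof (rule mem)
      show "S \<inter> T \<subseteq> X" using that MX by blast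
      fix F assume "finite F" "F \<subseteq> M"
      then have "infinite (X \<inter> \<Inter>(insert S (insert T F)))"
        using that by (intro Minf) auto
      moreover have "X \<inter> \<Inter>(insert S (insert T F)) = X \<inter> \<Inter>F \<inter> (S \<inter> T)" by blast
      ultimately show "infinite (X \<inter> \<Inter>F \<inter> (S \<inter> T))" by simp
    qed
    show "T \<in> M" if "S \<in> M" "S \<subseteq> T \<and> T \<subseteq> X" for S T
    proof (rule mem)
      show "T \<subseteq> X" using that by blast
      fix F assume "finite F" "F \<subseteq> M"
      then have "infinite (X \<inter> \<Inter>(insert S F))" using that by (intro Minf) auto
      moreover have "X \<inter> \<Inter>(insert S F) \<subseteq> X \<inter> \<Inter>F \<inter> T" using that by blast
      ultimately show "infinite (X \<inter> \<Inter>F \<inter> T)" using finite_subset by blast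
    qed
    show "S \<in> M \<or> X - S \<in> M" if S: "S \<subseteq> X" for S
    proof (rule ccontr)
      assume neg: "\<not> (S \<in> M \<or> X - S \<in> M)"
      obtain F where F: "finite F" "F \<subseteq> M" "finite (X \<inter> \<Inter>F \<inter> S)"
        using mem[OF S] neg by blast
      obtain H where H: "finite H" "H \<subseteq> M" "finite (X \<inter> \<Inter>H \<inter> (X - S))"
        using mem[of "X - S"] neg by blast
      have "X \<inter> \<Inter>(F \<union> H) \<subseteq> (X \<inter> \<Inter>F \<inter> S) \<union> (X \<inter> \<Inter>H \<inter> (X - S))" by blast
      then have "finite (X \<inter> \<Inter>(F \<union> H))"
        using F(3) H(3) by (meson finite_UnI finite_subset)
      then show False using Minf[of "F \<union> H"] F H by blast
    qed
  qed
  then have "M \<in> free_ultrafilters X" using Mone by (simp add: free_ultrafilters_iff)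
  then show thesis using EM that by blast
qed

lemma infinite_imp_free_ultrafilter:
  assumes "B \<subseteq> X" and "infinite B"
  obtains p where "p \<in> free_ultrafilters X" and "B \<in> p"
proof -
  have "infinite (X \<inter> \<Inter>F)" if "F \<subseteq> {B}" for F
  proof -
    have "B \<subseteq> X \<inter> \<Inter>F" using that assms(1) by blast
    then show ?thesis using assms(2) finite_subset by blast
  qed
  then obtain p where "p \<in> free_ultrafilters X" "{B} \<subseteq> p"
    using free_ultrafilter_extension[of "{B}" X] assms(1) by blast
  then show thesis using that by blast
qed

lemma openin_basic_open:
  "S \<subseteq> X \<Longrightarrow> openin (stone_cech_topology X) (basic_open X S)"
  unfolding stone_cech_topology_def by (rule topology_generated_by_Basis) blast

lemma topspace_stone_cech [simp]: "topspace (stone_cech_topology X) = stone_cech X"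
proof -
  have "basic_open X X = stone_cech X"
    by (auto simp: basic_open_def stone_cech_def ultrafilter_on_def)
  then show ?thesis
    unfolding stone_cech_topology_def topology_generated_by_topspace by (auto simp: basic_open_def)
qed

section \<open>Products and translates of ultrafilters\<close>

lemma (in group) mem_inv_l_coset_iff:
  assumes "g \<in> carrier G" and "S \<subseteq> carrier G"
  shows "x \<in> inv g <# S \<longleftrightarrow> x \<in> carrier G \<and> g \<otimes> x \<in> S"
proof
  assume "x \<in> inv g <# S"
  then obtain s where s: "s \<in> S" "x = inv g \<otimes> s" by (auto simp: l_coset_def)
  then have "s \<in> carrier G" using assms by blast
  then show "x \<in> carrier G \<and> g \<otimes> x \<in> S" using s assms by (simp add: m_assoc[symmetric])
next
  assume x: "x \<in> carrier G \<and> g \<otimes> x \<in> S"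
  then have "x = inv g \<otimes> (g \<otimes> x)" using assms by (simp add: m_assoc[symmetric])
  then show "x \<in> inv g <# S" using x by (auto simp: l_coset_def)
qed

text \<open>The elements \<open>g\<close> with \<open>A \<in> gr\<close>; then \<open>A \<in> qr\<close> if and only if this set lies in \<open>q\<close>.\<close>

definition return_set :: "('a, 'b) monoid_scheme \<Rightarrow> 'a set \<Rightarrow> 'a set set \<Rightarrow> 'a set" where
  "return_set G A r = {g \<in> carrier G. inv\<^bsub>G\<^esub> g <#\<^bsub>G\<^esub> A \<in> r}"

lemma mem_ultrafilter_mult_iff:
  "S \<in> ultrafilter_mult G q r \<longleftrightarrow> S \<subseteq> carrier G \<and> return_set G S r \<in> q"
  by (simp add: ultrafilter_mult_def return_set_def)

lemma return_set_subset: "return_set G A r \<subseteq> carrier G"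
  by (auto simp: return_set_def)

context group
begin

lemma ultrafilter_on_mult:
  assumes q: "ultrafilter_on (carrier G) q" and r: "ultrafilter_on (carrier G) r"
  shows "ultrafilter_on (carrier G) (ultrafilter_mult G q r)"
proof -
  note rs = return_set_subset[of G _ r]
  have carr: "return_set G (carrier G) r = carrier G"
  proof -
    have "inv g <# carrier G = carrier G" if "g \<in> carrier G" for g
      using that by (auto simp: mem_inv_l_coset_iff)
    then show ?thesis using r by (auto simp: return_set_def ultrafilter_on_def)
  qed
  have empty: "return_set G {} r = {}"
    using r by (auto simp: return_set_def l_coset_def ultrafilter_on_def)
  have int: "return_set G S r \<inter> return_set G T r \<subseteq> return_set G (S \<inter> T) r"
    if "S \<subseteq> carrier G" "T \<subseteq> carrier G" for S T
  proof
    fix g assume g: "g \<in> return_set G S r \<inter> return_set G T r"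
    then have "g \<in> carrier G" by (simp add: return_set_def)
    then have "inv g <# (S \<inter> T) = (inv g <# S) \<inter> (inv g <# T)"
      using that by (auto simp: mem_inv_l_coset_iff le_infI1)
    then show "g \<in> return_set G (S \<inter> T) r"
      using g r by (simp add: return_set_def ultrafilter_on_def)
  qed
  have mono: "return_set G S r \<subseteq> return_set G T r"
    if "S \<subseteq> T" "T \<subseteq> carrier G" for S T
  proof
    fix g assume g: "g \<in> return_set G S r"
    then have "g \<in> carrier G" by (simp add: return_set_def)
    then have "inv g <# S \<subseteq> inv g <# T" "inv g <# T \<subseteq> carrier G"
      using that by (auto simp: mem_inv_l_coset_iff l_coset_def)
    then show "g \<in> return_set G T r"
      using g r unfolding return_set_def ultrafilter_on_def by blast
  qed
  have compl: "return_set G (carrier G - S) r = carrier G - return_set G S r"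
    if S: "S \<subseteq> carrier G" for S
  proof -
    have "inv g <# (carrier G - S) = carrier G - (inv g <# S)" "inv g <# S \<subseteq> carrier G"
      if "g \<in> carrier G" for g
      using that S by (auto simp: mem_inv_l_coset_iff)
    then show ?thesis
      using ultrafilter_compl_iff[OF r] by (auto simp: return_set_def)
  qed
  have q_up: "T \<in> q" if "S \<in> q" "S \<subseteq> T" "T \<subseteq> carrier G" for S T
    using that q unfolding ultrafilter_on_def by blast
  show ?thesis
    unfolding ultrafilter_on_def
  proof (intro conjI ballI allI impI)
    show "ultrafilter_mult G q r \<subseteq> Pow (carrier G)"
      by (auto simp: mem_ultrafilter_mult_iff)
    show "carrier G \<in> ultrafilter_mult G q r"
      using q carr by (simp add: mem_ultrafilter_mult_iff ultrafilter_on_def)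
    show "{} \<notin> ultrafilter_mult G q r"
      using q empty by (simp add: mem_ultrafilter_mult_iff ultrafilter_on_def)
    show "S \<inter> T \<in> ultrafilter_mult G q r"
      if "S \<in> ultrafilter_mult G q r" "T \<in> ultrafilter_mult G q r" for S T
    proof -
      have "return_set G S r \<inter> return_set G T r \<in> q"
        using that q by (simp add: mem_ultrafilter_mult_iff ultrafilter_on_def)
      then show ?thesis
        using that q_up[OF _ int rs] by (auto simp: mem_ultrafilter_mult_iff)
    qed
    show "T \<in> ultrafilter_mult G q r"
      if "S \<in> ultrafilter_mult G q r" "S \<subseteq> T \<and> T \<subseteq> carrier G" for S T
      using that q_up[OF _ mono rs] by (auto simp: mem_ultrafilter_mult_iff)
    show "S \<in> ultrafilter_mult G q r \<or> carrier G - S \<in> ultrafilter_mult G q r"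
      if "S \<subseteq> carrier G" for S
      using that compl[OF that] ultrafilter_compl_iff[OF q rs]
      by (auto simp: mem_ultrafilter_mult_iff)
  qed
qed

text \<open>No translate of a finite set belongs to a free \<open>r\<close>, so finite sets have empty return
  sets.\<close>

lemma ultrafilter_mult_free:
  assumes q: "ultrafilter_on (carrier G) q" and r: "r \<in> free_ultrafilters (carrier G)"
  shows "ultrafilter_mult G q r \<in> free_ultrafilters (carrier G)"
proof -
  have "infinite S" if "S \<in> ultrafilter_mult G q r" for S
  proof
    assume "finite S"
    then have "finite (inv g <# S)" for g by (simp add: l_coset_def)
    then have "return_set G S r = {}"
      using r by (auto simp: return_set_def free_ultrafilters_iff)
    then show False
      using that q by (auto simp: mem_ultrafilter_mult_iff ultrafilter_on_def)
  qed
  then show ?thesis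
    using ultrafilter_on_mult[OF q] r by (simp add: free_ultrafilters_iff)
qed

lemma mem_left_translate_iff:
  assumes "g \<in> carrier G"
  shows "S \<in> ultrafilter_mult G (principal_ultrafilter (carrier G) g) r
    \<longleftrightarrow> S \<subseteq> carrier G \<and> inv g <# S \<in> r"
  using assms by (auto simp: ultrafilter_mult_def principal_ultrafilter_def)

text \<open>Let \<open>S\<close> be maximal with \<open>S \<inter> kS = {}\<close>. If \<open>x \<notin> S\<close>, then enlarging \<open>S\<close> by \<open>x\<close> creates a
  conflict; as \<open>kx \<noteq> x\<close>, this means that \<open>x\<close> has a neighbour
  \<open>kx\<close> or \<open>k\<^sup>-\<^sup>1x\<close> in \<open>S\<close>.\<close>

lemma ex_translation_avoiding_set:
  assumes k: "k \<in> carrier G" "k \<noteq> \<one>"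
  obtains S where "S \<subseteq> carrier G" and "\<And>x. x \<in> S \<Longrightarrow> k \<otimes> x \<notin> S"
    and "\<And>x. x \<in> carrier G \<Longrightarrow> x \<in> S \<or> k \<otimes> x \<in> S \<or> inv k \<otimes> x \<in> S"
proof -
  define \<Phi> where "\<Phi> = {S. S \<subseteq> carrier G \<and> (\<forall>x\<in>S. k \<otimes> x \<notin> S)}"
  have "\<exists>S\<in>\<Phi>. \<forall>T\<in>\<Phi>. S \<subseteq> T \<longrightarrow> T = S"
  proof (rule subset_Zorn_nonempty)
    show "\<Phi> \<noteq> {}" by (auto simp: \<Phi>_def)
    fix C assume C: "C \<noteq> {}" "subset.chain \<Phi> C"
    have "k \<otimes> x \<notin> \<Union>C" if x: "x \<in> \<Union>C" for x
    proof
      assume "k \<otimes> x \<in> \<Union>C"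
      then obtain S T where ST: "S \<in> C" "T \<in> C" "x \<in> S" "k \<otimes> x \<in> T" using x by blast
      then have "S \<subseteq> T \<or> T \<subseteq> S" "S \<in> \<Phi>" "T \<in> \<Phi>"
        using C by (auto simp: subset.chain_def)
      then show False using ST by (auto simp: \<Phi>_def)
    qed
    moreover have "\<Union>C \<subseteq> carrier G" using C by (auto simp: subset.chain_def \<Phi>_def)
    ultimately show "\<Union>C \<in> \<Phi>" by (auto simp: \<Phi>_def)
  qed
  then obtain S where S: "S \<in> \<Phi>" and max: "\<And>T. T \<in> \<Phi> \<Longrightarrow> S \<subseteq> T \<Longrightarrow> T = S"
    by blast
  have "x \<in> S \<or> k \<otimes> x \<in> S \<or> inv k \<otimes> x \<in> S" if x: "x \<in> carrier G" for x
  proof (rule ccontr)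
    assume neg: "\<not> ?thesis"
    have "k \<otimes> x \<noteq> x" using k x by (simp add: r_cancel_one)
    moreover have "k \<otimes> s \<noteq> x" if "s \<in> S" for s
    proof
      assume "k \<otimes> s = x"
      moreover have "s \<in> carrier G" using that S by (auto simp: \<Phi>_def)
      ultimately have "inv k \<otimes> x = s" using k by (auto simp: m_assoc[symmetric])
      then show False using neg that by simp
    qed
    ultimately have "insert x S \<in> \<Phi>" using S x neg by (auto simp: \<Phi>_def)
    then show False using max[of "insert x S"] neg by blast
  qed
  then show thesis using S that by (auto simp: \<Phi>_def)
qed

text \<open>Apply the preceding set to \<open>k = g\<^sup>-\<^sup>1h\<close>: the sets \<open>S\<close>, \<open>k\<^sup>-\<^sup>1S\<close> and \<open>kS\<close> cover the group, so \<open>p\<close>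
  contains one of them. As \<open>kp = p\<close>, membership in \<open>p\<close> is invariant under translation by \<open>k\<close>,
  so \<open>p\<close> contains both \<open>S\<close> and \<open>k\<^sup>-\<^sup>1S\<close>, which are disjoint.\<close>

lemma left_translates_distinct:
  assumes p: "ultrafilter_on (carrier G) p"
    and g: "g \<in> carrier G" and h: "h \<in> carrier G"
    and eq: "ultrafilter_mult G (principal_ultrafilter (carrier G) g) p
      = ultrafilter_mult G (principal_ultrafilter (carrier G) h) p"
  shows "g = h"
proof (rule ccontr)
  assume "g \<noteq> h"
  define k where "k = inv g \<otimes> h"
  have k: "k \<in> carrier G" using g h by (simp add: k_def)
  have "k \<noteq> \<one>"
    using \<open>g \<noteq> h\<close> g h by (metis k_def inv_closed inv_equality inv_inv)
  then obtain S where S: "S \<subseteq> carrier G" and disj: "\<And>x. x \<in> S \<Longrightarrow> k \<otimes> x \<notin> S"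
    and cover: "\<And>x. x \<in> carrier G \<Longrightarrow> x \<in> S \<or> k \<otimes> x \<in> S \<or> inv k \<otimes> x \<in> S"
    using ex_translation_avoiding_set[OF k] by blast
  have shift: "T \<in> p \<longleftrightarrow> inv k <# T \<in> p" if T: "T \<subseteq> carrier G" for T
  proof -
    \<comment> \<open>Testing \<open>gp = hp\<close> on the set \<open>gT\<close> turns the two translates into \<open>T\<close> and \<open>k\<^sup>-\<^sup>1T\<close>.\<close>
    have gT: "g <# T \<subseteq> carrier G" using T g by (auto simp: l_coset_def)
    have "inv g <# (g <# T) = T" using T g by (simp add: lcos_m_assoc lcos_mult_one)
    moreover have "inv h <# (g <# T) = inv k <# T"
      using T g h by (simp add: lcos_m_assoc k_def inv_mult_group)
    ultimately show ?thesis
      using eq mem_left_translate_iff[OF g, of "g <# T" p]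
        mem_left_translate_iff[OF h, of "g <# T" p] gT by simp
  qed
  have kS: "inv k <# S \<subseteq> carrier G" "k <# S \<subseteq> carrier G"
    using k S by (auto simp: l_coset_def)
  have inv_kk: "inv k <# (k <# S) = S" using S k by (simp add: lcos_m_assoc lcos_mult_one)
  have "S \<in> p"
  proof (rule ccontr)
    assume n: "S \<notin> p"
    then have "inv k <# S \<notin> p" "k <# S \<notin> p"
      using shift[OF S] shift[OF kS(2)] inv_kk by simp_all
    then have "carrier G - S \<in> p" "carrier G - (inv k <# S) \<in> p" "carrier G - (k <# S) \<in> p"
      using n ultrafilter_compl_iff[OF p] S kS by simp_all
    then have "(carrier G - S) \<inter> ((carrier G - (inv k <# S)) \<inter> (carrier G - (k <# S))) \<in> p"
      using p by (simp add: ultrafilter_on_def)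
    moreover have "(carrier G - S) \<inter> ((carrier G - (inv k <# S)) \<inter> (carrier G - (k <# S))) = {}"
      using cover mem_inv_l_coset_iff[OF k S] mem_inv_l_coset_iff[of "inv k" S] k S by auto
    ultimately show False using p by (simp add: ultrafilter_on_def)
  qed
  then have "S \<inter> (inv k <# S) \<in> p" using shift[OF S] p by (simp add: ultrafilter_on_def)
  moreover have "S \<inter> (inv k <# S) = {}" using disj mem_inv_l_coset_iff[OF k S] by auto
  ultimately show False using p by (simp add: ultrafilter_on_def)
qed

section \<open>Infinite return sets\<close>

text \<open>Acting on \<open>r\<close> maps the return set bijectively onto the companion; translates of a free
  ultrafilter are free, so the restriction to free ultrafilters loses nothing.\<close>

lemma finite_companion_iff:
  assumes A: "A \<subseteq> carrier G" and r: "r \<in> free_ultrafilters (carrier G)"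
  shows "finite (companion G r A) \<longleftrightarrow> finite (return_set G A r)"
proof -
  let ?t = "\<lambda>g. ultrafilter_mult G (principal_ultrafilter (carrier G) g) r"
  have u: "ultrafilter_on (carrier G) r" using r by (simp add: free_ultrafilters_iff)
  have free: "?t g \<in> free_ultrafilters (carrier G)" if "g \<in> carrier G" for g
    using that by (intro ultrafilter_mult_free ultrafilter_on_principal r)
  then have "?t g \<in> star_set (carrier G) A \<longleftrightarrow> g \<in> return_set G A r"
    if "g \<in> carrier G" for g
    using that A mem_left_translate_iff[OF that, of A r] free[OF that]
    by (auto simp: star_set_def basic_open_def free_ultrafilters_def return_set_def)
  then have "companion G r A = ?t ` return_set G A r"
    using return_set_subset[of G A r] by (auto simp: companion_def ultrafilter_orbit_def)
  moreover have "inj_on ?t (return_set G A r)"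
    using left_translates_distinct[OF u] return_set_subset[of G A r]
    by (intro inj_onI) blast
  ultimately show ?thesis by (simp add: finite_image_iff)
qed

lemma sparse_iff_finite_return_sets:
  assumes "A \<subseteq> carrier G"
  shows "sparse_subset G A \<longleftrightarrow>
    (\<forall>r \<in> free_ultrafilters (carrier G). finite (return_set G A r))"
  using finite_companion_iff[OF assms] by (simp add: sparse_subset_def)

text \<open>An infinite return set of \<open>r\<close> lies in some free \<open>q\<close>, and then \<open>qr\<close> itself is a point of
  \<open>A\<^sup>*\<close> that is not strongly prime. Conversely, a point of \<open>A\<^sup>*\<close> in the closure of the products
  yields a product \<open>qr\<close> containing \<open>A\<close>, though perhaps a different point.\<close>

lemma strongly_prime_iff_finite_return_sets:
  assumes A: "A \<subseteq> carrier G"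
  shows "(\<forall>p \<in> star_set (carrier G) A. strongly_prime G p) \<longleftrightarrow>
    (\<forall>r \<in> free_ultrafilters (carrier G). finite (return_set G A r))"
proof -
  let ?free = "free_ultrafilters (carrier G)"
  let ?prods = "{ultrafilter_mult G q r | q r. q \<in> ?free \<and> r \<in> ?free}"
  let ?cl = "stone_cech_topology (carrier G) closure_of ?prods"
  have prods_free: "?prods \<subseteq> ?free"
  proof
    fix s assume "s \<in> ?prods"
    then obtain q r where qr: "q \<in> ?free" "r \<in> ?free" and s: "s = ultrafilter_mult G q r"
      by blast
    have "ultrafilter_on (carrier G) q" using qr by (simp add: free_ultrafilters_iff)
    then show "s \<in> ?free" unfolding s using qr by (intro ultrafilter_mult_free)
  qed
  have free_sc: "?free \<subseteq> stone_cech (carrier G)" by (auto simp: free_ultrafilters_def)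
  show ?thesis
  proof (intro iffI ballI)
    fix r assume prime: "\<forall>p \<in> star_set (carrier G) A. strongly_prime G p" and r: "r \<in> ?free"
    show "finite (return_set G A r)"
    proof (rule ccontr)
      assume "infinite (return_set G A r)"
      then obtain q where q: "q \<in> ?free" "return_set G A r \<in> q"
        using infinite_imp_free_ultrafilter[OF return_set_subset] by metis
      define p where "p = ultrafilter_mult G q r"
      have prod: "p \<in> ?prods" using q(1) r unfolding p_def by blast
      then have free: "p \<in> ?free" by (rule subsetD[OF prods_free])
      have "?prods \<subseteq> ?cl"
        by (rule closure_of_subset, unfold topspace_stone_cech)
          (rule order_trans[OF prods_free free_sc])
      then have "p \<in> ?cl" using prod by (rule subsetD)
      then have "\<not> strongly_prime G p" by (simp add: strongly_prime_def)
      moreover have "A \<in> p" using A q by (simp add: p_def mem_ultrafilter_mult_iff)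
      then have "p \<in> star_set (carrier G) A"
        using free free_sc by (auto simp: star_set_def basic_open_def)
      ultimately show False using prime by blast
    qed
  next
    fix p assume fin: "\<forall>r \<in> ?free. finite (return_set G A r)"
      and p: "p \<in> star_set (carrier G) A"
    have "p \<notin> ?cl"
    proof
      assume "p \<in> ?cl"
      moreover have "p \<in> basic_open (carrier G) A" using p by (simp add: star_set_def)
      ultimately obtain s where s: "s \<in> ?prods" "s \<in> basic_open (carrier G) A"
        using openin_basic_open[OF A] unfolding in_closure_of by blast
      then obtain q r where qr: "q \<in> ?free" "r \<in> ?free" "s = ultrafilter_mult G q r" by blast
      then have "return_set G A r \<in> q"
        using s by (simp add: basic_open_def mem_ultrafilter_mult_iff)
      then show False using qr fin by (auto simp: free_ultrafilters_iff)
    qed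
    then show "strongly_prime G p" using p by (simp add: strongly_prime_def star_set_def)
  qed
qed

text \<open>Inversion matches the two sides: \<open>xA \<in> r\<close> says that \<open>x\<^sup>-\<^sup>1\<close> is in the return set. From an
  infinite return set one takes \<open>X\<close> to be its set of inverses; conversely, an infinite \<open>X\<close> with
  infinite finite intersections of translates gives an \<open>r\<close> containing all these translates.\<close>

lemma finite_translate_intersections_iff_finite_return_sets:
  assumes A: "A \<subseteq> carrier G"
  shows "(\<forall>X. X \<subseteq> carrier G \<and> infinite X \<longrightarrow>
      (\<exists>F. finite F \<and> F \<subseteq> X \<and> finite (\<Inter>g\<in>F. g <# A))) \<longleftrightarrow>
    (\<forall>r \<in> free_ultrafilters (carrier G). finite (return_set G A r))"
proof (intro iffI ballI allI impI)
  fix r assume r: "r \<in> free_ultrafilters (carrier G)"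
    and fin: "\<forall>X. X \<subseteq> carrier G \<and> infinite X \<longrightarrow>
      (\<exists>F. finite F \<and> F \<subseteq> X \<and> finite (\<Inter>g\<in>F. g <# A))"
  show "finite (return_set G A r)"
  proof (rule ccontr)
    assume inf: "infinite (return_set G A r)"
    define X where "X = (\<lambda>g. inv g) ` return_set G A r"
    have "inj_on (\<lambda>g. inv g) (return_set G A r)"
      using return_set_subset by (rule inj_on_subset[OF inv_inj])
    then have "infinite X" using inf by (simp add: X_def finite_image_iff)
    moreover have "X \<subseteq> carrier G" using return_set_subset[of G A r] by (auto simp: X_def)
    ultimately obtain F where F: "finite F" "F \<subseteq> X" "finite (\<Inter>g\<in>F. g <# A)"
      using fin by blast
    have "(\<lambda>g. g <# A) ` F \<subseteq> r" using F(2) by (auto simp: X_def return_set_def)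
    then have "carrier G \<inter> (\<Inter>g\<in>F. g <# A) \<in> r"
      using ultrafilter_Inter[of "carrier G" r "(\<lambda>g. g <# A) ` F"] r F(1)
      by (simp add: free_ultrafilters_iff)
    then show False using r F(3) by (auto simp: free_ultrafilters_iff)
  qed
next
  fix X assume fin: "\<forall>r \<in> free_ultrafilters (carrier G). finite (return_set G A r)"
    and X: "X \<subseteq> carrier G \<and> infinite X"
  show "\<exists>F. finite F \<and> F \<subseteq> X \<and> finite (\<Inter>g\<in>F. g <# A)"
  proof (rule ccontr)
    assume neg: "\<not> ?thesis"
    have sub: "g <# A \<subseteq> carrier G" if "g \<in> X" for g
      using that X A by (auto simp: l_coset_def)
    have "infinite (carrier G \<inter> \<Inter>E)" if E: "finite E" "E \<subseteq> (\<lambda>g. g <# A) ` X" for E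
    proof -
      obtain F where F: "F \<subseteq> X" "finite F" "E = (\<lambda>g. g <# A) ` F"
        using finite_subset_image[OF E] by blast
      \<comment> \<open>For empty \<open>F\<close> the intersection of the translates is the whole type, which may
        exceed the carrier.\<close>
      show ?thesis
      proof (cases "F = {}")
        case True
        then show ?thesis using F X finite_subset by auto
      next
        case False
        then have "carrier G \<inter> \<Inter>E = (\<Inter>g\<in>F. g <# A)" using F sub by blast
        then show ?thesis using F neg by auto
      qed
    qed
    then obtain r where r: "r \<in> free_ultrafilters (carrier G)" "(\<lambda>g. g <# A) ` X \<subseteq> r"
      using free_ultrafilter_extension[of "(\<lambda>g. g <# A) ` X" "carrier G"] sub by blast
    have "(\<lambda>g. inv g) ` X \<subseteq> return_set G A r"
    proof
      fix h assume "h \<in> (\<lambda>g. inv g) ` X"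
      then obtain g where "g \<in> X" "h = inv g" by blast
      moreover then have "g \<in> carrier G" using X by blast
      ultimately show "h \<in> return_set G A r" using r(2) by (auto simp: return_set_def)
    qed
    moreover have "inj_on (\<lambda>g. inv g) X" using X inj_on_subset[OF inv_inj] by blast
    ultimately have "infinite (return_set G A r)"
      using X by (meson finite_imageD finite_subset)
    then show False using fin r(1) by blast
  qed
qed

end

theorem proposition5:
  fixes G :: "('a, 'b) monoid_scheme" and A :: "'a set"
  assumes "group G" and "A \<subseteq> carrier G"
  shows "(sparse_subset G A \<longleftrightarrow> (\<forall>p \<in> star_set (carrier G) A. strongly_prime G p)) \<and>
         ((\<forall>p \<in> star_set (carrier G) A. strongly_prime G p) \<longleftrightarrow>
          (\<forall>X. X \<subseteq> carrier G \<and> infinite X \<longrightarrow>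
             (\<exists>F. finite F \<and> F \<subseteq> X \<and> finite (\<Inter>g\<in>F. g <#\<^bsub>G\<^esub> A))))"
  by (simp only: group.sparse_iff_finite_return_sets[OF assms]
      group.strongly_prime_iff_finite_return_sets[OF assms]
      group.finite_translate_intersections_iff_finite_return_sets[OF assms] simp_thms)

end
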